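(* Let $p\ge 2$ be an integer. Suppose that $f(z)=h(z)+\overline{g(z)}=\sum_{n=0}^\infty a_n z^{pn+1}+\overline{\sum_{n=0}^\infty b_n z^{pn+1}}$ is a harmonic $p$-symmetric function in the unit disk $\mathbb{D}$, where $h$ and $g$ are bounded functions in $\mathbb{D}$. Then $$\sum_{n=0}^\infty(|a_n|+|b_n|)r^{pn+1}\le\max\{\|h\|_\infty,\|g\|_\infty\}\quad\text{for } 0\le r\le\frac12.$$ The number $1/2$ is sharp, i.e. for every $r\in(1/2,1)$ there is such an $f$ for which the inequality fails at $r$.
   Context: $\mathbb{D}=\{z\in\mathbb{C}:|z|<1\}$ and $\|h\|_\infty=\sup_{z\in\mathbb{D}}|h(z)|$, $\|g\|_\infty=\sup_{z\in\mathbb{D}}|g(z)|$. Here $h(z)=\sum_{n\ge0}a_nz^{pn+1}$ and $g(z)=\sum_{n\ge0}b_nz^{pn+1}$ are analytic in $\mathbb{D}$; "$p$-symmetric" refers to this form of the power series. *)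

theory Defs
  imports "HOL-Complex_Analysis.Complex_Analysis"
begin

(* A real supremum: only meaningful for F bounded on the disk. *)
definition disk_sup_norm :: "(complex \<Rightarrow> complex) \<Rightarrow> real" where
  "disk_sup_norm F = (SUP z\<in>ball 0 1. norm (F z))"

definition p_symmetric_analytic :: "nat \<Rightarrow> (nat \<Rightarrow> complex) \<Rightarrow> (complex \<Rightarrow> complex) \<Rightarrow> bool" where
  "p_symmetric_analytic p c F \<longleftrightarrow>
     F analytic_on ball 0 1 \<and>
     (\<forall>z\<in>ball 0 1. (\<lambda>n. c n * z ^ (p * n + 1)) sums F z)"

(* The decomposition f = h + cnj g and the coefficients are carried as arguments, since
   the inequality is about them; f is harmonic as a sum of an analytic and an
   anti-analytic function. *)
definition p_symmetric_harmonic ::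
  "nat \<Rightarrow> (complex \<Rightarrow> complex) \<Rightarrow> (complex \<Rightarrow> complex) \<Rightarrow> (complex \<Rightarrow> complex) \<Rightarrow>
   (nat \<Rightarrow> complex) \<Rightarrow> (nat \<Rightarrow> complex) \<Rightarrow> bool" where
  "p_symmetric_harmonic p f h g a b \<longleftrightarrow>
     p_symmetric_analytic p a h \<and> p_symmetric_analytic p b g \<and>
     (\<forall>z\<in>ball 0 1. f z = h z + cnj (g z))"

end

theory Submission imports Defs begin

text \<open>
  Write \<open>h z = z * H (z ^ p)\<close> with \<open>H u = (\<Sum>n. a n * u ^ n)\<close>. The Schwarz lemma divides out the factor
  \<open>z\<close> without increasing the bound, so \<open>H\<close> is bounded by \<open>\<parallel>h\<parallel>\<close> on the disk. Bohr's theorem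
  bounds \<open>\<Sum>n. \<bar>a n\<bar> * \<rho> ^ n\<close> by \<open>\<parallel>h\<parallel>\<close> for \<open>\<rho> \<le> 1/3\<close>; since \<open>p \<ge> 2\<close> and \<open>r \<le> 1/2\<close> make
  \<open>r ^ p \<le> 1/4\<close>, the analytic part contributes at most \<open>r * \<parallel>h\<parallel> \<le> \<parallel>h\<parallel> / 2\<close>. The same holds for
  \<open>g\<close>, and the two halves add up to at most the maximum. The first
  coefficients alone can fill this bound: \<open>h = g = id\<close> has the sum \<open>2 * r\<close> against a maximum of at
  most \<open>1\<close>, so the inequality fails for \<open>r > 1/2\<close>.

  Bohr's theorem rests on the coefficient estimate \<open>\<bar>c n\<bar> \<le> 1 - \<bar>c 0\<bar>\<^sup>2\<close> for functions into the
  unit disk. For \<open>n = 1\<close> this is the Schwarz--Pick inequality at the origin. Averaging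
  \<open>F (\<omega> * z)\<close> over the \<open>n\<close>-th roots of unity \<open>\<omega>\<close> keeps only the powers of \<open>z ^ n\<close>, which
  reduces general \<open>n\<close> to that case.
\<close>

section \<open>Coefficients of self-maps of the disk\<close>

lemma power_series_on_disk:
  fixes c :: "nat \<Rightarrow> complex"
  assumes "\<And>z. norm z < 1 \<Longrightarrow> (\<lambda>n. c n * z ^ n) sums F z"
  shows "F holomorphic_on ball 0 1" and "(F has_field_derivative c 1) (at 0)"
proof -
  show "F holomorphic_on ball 0 1"
    using power_series_holomorphic[of 0 1 c F] assms by simp
  have "summable (\<lambda>n. c n * (1/2) ^ n)"
    using assms[of "1/2"] by (simp add: sums_iff)
  then have "((\<lambda>z. \<Sum>n. c n * z ^ n) has_field_derivative (\<Sum>n. diffs c n * 0 ^ n)) (at 0)"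
    by (rule termdiffs_strong) simp
  then have "((\<lambda>z. \<Sum>n. c n * z ^ n) has_field_derivative c 1) (at 0)"
    by (simp add: diffs_def)
  then show "(F has_field_derivative c 1) (at 0)"
    by (rule has_field_derivative_transform_within_open[of _ _ _ "ball 0 1"])
      (use assms in \<open>auto simp: sums_iff\<close>)
qed

lemma power_series_at_0:
  fixes c :: "nat \<Rightarrow> complex"
  assumes "(\<lambda>n. c n * 0 ^ n) sums s"
  shows "s = c 0"
  using assms by (simp add: sums_iff)

text \<open>Schwarz--Pick at the origin: composing with the Moebius map that sends \<open>F 0\<close> to \<open>0\<close> gives a
  function to which the Schwarz lemma applies, and whose derivative at \<open>0\<close> is \<open>F' 0 / (1 - \<bar>F 0\<bar>\<^sup>2)\<close>.\<close>

lemma Schwarz_Pick_at_0: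
  assumes hol: "F holomorphic_on ball 0 1"
    and lt1: "\<And>z. norm z < 1 \<Longrightarrow> norm (F z) < 1"
    and der: "(F has_field_derivative d) (at 0)"
  shows "norm d \<le> 1 - (norm (F 0))\<^sup>2"
proof -
  define w where "w = F 0"
  have w: "norm w < 1"
    using lt1[of 0] by (simp add: w_def)
  have ww: "cnj w * w = of_real ((norm w)\<^sup>2)"
    by (metis complex_norm_square mult.commute of_real_power)
  have lt: "(norm w)\<^sup>2 < 1"
    using w by (simp add: abs_square_less_1)
  have nz: "1 - cnj w * w \<noteq> 0"
    using lt unfolding ww by (metis less_irrefl of_real_1 of_real_eq_iff right_minus_eq)
  define \<phi> where "\<phi> = Moebius_function 0 w \<circ> F"
  have "\<phi> holomorphic_on ball 0 1"
    unfolding \<phi>_def using lt1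
    by (intro holomorphic_on_compose_gen[OF hol Moebius_function_holomorphic[OF w]]) auto
  moreover have "\<phi> 0 = 0"
    by (simp add: \<phi>_def w_def Moebius_function_eq_zero)
  moreover have "norm (\<phi> z) < 1" if "norm z < 1" for z
    using Moebius_function_norm_lt_1[OF w lt1[OF that]] by (simp add: \<phi>_def)
  ultimately have le1: "norm (deriv \<phi> 0) \<le> 1"
    using Schwarz_Lemma(2)[of \<phi> 0] by simp
  have "((\<lambda>z. (F z - w) / (1 - cnj w * F z)) has_field_derivative
      (d * (1 - cnj w * F 0) - (F 0 - w) * (- (cnj w * d)))
        / ((1 - cnj w * F 0) * (1 - cnj w * F 0))) (at 0)"
    by (rule DERIV_divide) (use nz in \<open>auto simp: w_def intro!: derivative_eq_intros der\<close>)
  then have "(\<phi> has_field_derivative d / (1 - cnj w * w)) (at 0)"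
    using nz unfolding \<phi>_def o_def Moebius_function_simple w_def[symmetric] by simp
  then have "norm d / norm (1 - cnj w * w) \<le> 1"
    using le1 by (simp add: DERIV_imp_deriv norm_divide)
  moreover have "norm (1 - cnj w * w) = 1 - (norm w)\<^sup>2"
    unfolding ww using lt by (metis abs_of_pos diff_gt_0_iff_gt norm_of_real of_real_1 of_real_diff)
  ultimately show ?thesis
    using lt unfolding w_def[symmetric] by (simp add: pos_divide_le_eq)
qed

lemma sum_powers_roots_of_unity:
  fixes n m :: nat
  assumes n: "n > 0"
  defines "\<omega> \<equiv> exp (2 * of_real pi * \<i> / of_nat n)"
  shows "(\<Sum>k<n. (\<omega> ^ k) ^ m) = (if n dvd m then of_nat n else 0)"
proof -
  have pow: "\<omega> ^ j = exp (2 * of_real pi * \<i> * of_nat j / of_nat n)" for j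
    unfolding \<omega>_def exp_of_nat_mult[symmetric] by (simp add: mult_ac)
  have "(\<omega> ^ k) ^ m = (\<omega> ^ m) ^ k" for k
    by (simp add: power_mult[symmetric] mult.commute)
  moreover have "(\<omega> ^ m) ^ n = 1"
    unfolding pow using complex_root_unity n by simp
  moreover have "\<omega> ^ m = 1 \<longleftrightarrow> n dvd m"
    unfolding pow using complex_root_unity_eq_1 n by simp
  ultimately show ?thesis
    by (auto simp: geometric_sum)
qed

text \<open>The averaging step: the coefficients with index divisible by \<open>n\<close> again form a power series
  with values in the unit disk, because its value at \<open>z ^ n\<close> is a mean of values of \<open>F\<close>.\<close>

lemma section_of_power_series:
  fixes c :: "nat \<Rightarrow> complex"
  assumes sums: "\<And>z. norm z < 1 \<Longrightarrow> (\<lambda>n. c n * z ^ n) sums F z"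
    and lt1: "\<And>z. norm z < 1 \<Longrightarrow> norm (F z) < 1"
    and n: "n > 0"
    and u: "norm u < 1"
  shows "\<exists>s. (\<lambda>j. c (n * j) * u ^ j) sums s \<and> norm s < 1"
proof -
  obtain z where z: "u = z ^ n"
    using exists_complex_root n by blast
  have nz: "norm z < 1"
    using u power_less_imp_less_base[of "norm z" n 1] by (simp add: z norm_power)
  define \<omega> where "\<omega> = exp (2 * of_real pi * \<i> / of_nat n)"
  have n\<omega>: "norm (\<omega> ^ k * z) < 1" for k
    using nz by (simp add: \<omega>_def norm_mult norm_power)
  define s where "s = (\<Sum>k<n. F (\<omega> ^ k * z)) / of_nat n"
  have "(\<lambda>m. (\<Sum>k<n. c m * (\<omega> ^ k * z) ^ m) / of_nat n) sums s"
    unfolding s_def by (intro sums_divide sums_sum sums n\<omega>)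
  moreover have "(\<Sum>k<n. c m * (\<omega> ^ k * z) ^ m) / of_nat n = (if n dvd m then c m * z ^ m else 0)" for m
  proof -
    have "(\<Sum>k<n. c m * (\<omega> ^ k * z) ^ m) = c m * z ^ m * (\<Sum>k<n. (\<omega> ^ k) ^ m)"
      by (simp add: sum_distrib_left power_mult_distrib mult_ac)
    also have "\<dots> = c m * z ^ m * (if n dvd m then of_nat n else 0)"
      unfolding \<omega>_def using sum_powers_roots_of_unity[OF n] by simp
    finally show ?thesis
      using n by simp
  qed
  ultimately have "(\<lambda>m. if n dvd m then c m * z ^ m else 0) sums s"
    by simp
  moreover have "strict_mono (\<lambda>j. n * j)"
    using n by (simp add: strict_mono_def)
  ultimately have "(\<lambda>j. if n dvd n * j then c (n * j) * z ^ (n * j) else 0) sums s"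
    by (subst sums_mono_reindex[where g = "\<lambda>j. n * j"]) (auto simp: dvd_def)
  then have "(\<lambda>j. c (n * j) * u ^ j) sums s"
    by (simp add: z power_mult)
  moreover have "norm (\<Sum>k<n. F (\<omega> ^ k * z)) < (\<Sum>k<n. 1::real)"
    using n by (intro le_less_trans[OF norm_sum] sum_strict_mono lt1 n\<omega>) auto
  then have "norm s < 1"
    using n by (simp add: s_def norm_divide divide_simps)
  ultimately show ?thesis
    by blast
qed

lemma coefficient_bound_unit_disk:
  fixes c :: "nat \<Rightarrow> complex"
  assumes sums: "\<And>z. norm z < 1 \<Longrightarrow> (\<lambda>n. c n * z ^ n) sums F z"
    and lt1: "\<And>z. norm z < 1 \<Longrightarrow> norm (F z) < 1"
    and n: "n > 0"
  shows "norm (c n) \<le> 1 - (norm (c 0))\<^sup>2"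
proof -
  obtain G where G: "\<And>u. norm u < 1 \<Longrightarrow> (\<lambda>j. c (n * j) * u ^ j) sums G u"
    "\<And>u. norm u < 1 \<Longrightarrow> norm (G u) < 1"
    using section_of_power_series[OF sums lt1 n] by metis
  note series = power_series_on_disk[of "\<lambda>j. c (n * j)", OF G(1)]
  have "G 0 = c 0"
    using power_series_at_0[of "\<lambda>j. c (n * j)"] G(1)[of 0] by simp
  then show ?thesis
    using Schwarz_Pick_at_0[OF series(1) G(2) series(2)] by simp
qed

section \<open>Bohr's theorem\<close>

text \<open>Put \<open>x = \<bar>c 0\<bar>\<close>. The radius \<open>1/3\<close> is where \<open>\<Sum>n\<ge>1. \<rho> ^ n = \<rho> / (1 - \<rho>)\<close> reaches \<open>1/2\<close>, and up to
  there the coefficient estimate bounds the sum by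
  \<open>x + (1 - x\<^sup>2) / 2 = 1 - (1 - x)\<^sup>2 / 2\<close>.\<close>

lemma Bohr:
  fixes c :: "nat \<Rightarrow> complex" and \<rho> :: real
  assumes sums: "\<And>z. norm z < 1 \<Longrightarrow> (\<lambda>n. c n * z ^ n) sums F z"
    and lt1: "\<And>z. norm z < 1 \<Longrightarrow> norm (F z) < 1"
    and \<rho>: "0 \<le> \<rho>" "\<rho> \<le> 1/3"
  shows "summable (\<lambda>n. norm (c n) * \<rho> ^ n)" and "(\<Sum>n. norm (c n) * \<rho> ^ n) \<le> 1"
proof -
  define x where "x = norm (c 0)"
  have "F 0 = c 0"
    using power_series_at_0 sums[of 0] by simp
  then have x: "0 \<le> x" "x < 1"
    using lt1[of 0] by (auto simp: x_def)
  have x2: "0 \<le> 1 - x\<^sup>2"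
    using x by (simp add: power_le_one)
  have geo: "(\<lambda>n. (1 - x\<^sup>2) * \<rho> * \<rho> ^ n) sums ((1 - x\<^sup>2) * \<rho> * (1 / (1 - \<rho>)))"
    using \<rho> by (intro sums_mult geometric_sums) auto
  have le: "norm (c (Suc n)) * \<rho> ^ Suc n \<le> (1 - x\<^sup>2) * \<rho> * \<rho> ^ n" for n
    using mult_right_mono[OF coefficient_bound_unit_disk[OF sums lt1], of "Suc n" "\<rho> ^ Suc n"] \<rho>(1)
    by (simp add: x_def mult.assoc)
  have tail: "summable (\<lambda>n. norm (c (Suc n)) * \<rho> ^ Suc n)"
    by (rule summable_comparison_test'[OF sums_summable[OF geo], of 0]) (use le \<rho>(1) in auto)
  then show summ: "summable (\<lambda>n. norm (c n) * \<rho> ^ n)"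
    by (subst (asm) summable_Suc_iff)
  have "(\<Sum>n. norm (c n) * \<rho> ^ n) = x + (\<Sum>n. norm (c (Suc n)) * \<rho> ^ Suc n)"
    using suminf_split_head[OF summ] by (simp add: x_def)
  also have "(\<Sum>n. norm (c (Suc n)) * \<rho> ^ Suc n) \<le> (1 - x\<^sup>2) * \<rho> * (1 / (1 - \<rho>))"
    using suminf_le[OF le tail sums_summable[OF geo]] sums_unique[OF geo] by simp
  also have "\<dots> = (1 - x\<^sup>2) * (\<rho> / (1 - \<rho>))"
    by simp
  also have "\<dots> \<le> (1 - x\<^sup>2) * (1 / 2)"
    using \<rho> x2 by (intro mult_left_mono) (auto simp: divide_simps)
  also have "x + (1 - x\<^sup>2) * (1 / 2) = 1 - (1 - x)\<^sup>2 / 2"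
    by (simp add: power2_eq_square field_simps)
  also have "\<dots> \<le> 1"
    by simp
  finally show "(\<Sum>n. norm (c n) * \<rho> ^ n) \<le> 1"
    by simp
qed

section \<open>Symmetric power series\<close>

text \<open>The Schwarz lemma divides \<open>h\<close> by \<open>z\<close>. Bounds \<open>K\<close> above the supremum \<open>M\<close> make the
  inequalities strict, as the Schwarz lemma and Bohr's theorem above want them, and let \<open>M = 0\<close>
  be treated like the other cases; \<open>K\<close> then tends to \<open>M\<close>.\<close>

lemma p_symmetric_Bohr:
  fixes a :: "nat \<Rightarrow> complex" and r M :: real
  assumes h: "p_symmetric_analytic p a h"
    and le: "\<And>z. norm z < 1 \<Longrightarrow> norm (h z) \<le> M"
    and p: "p > 0"
    and r: "0 \<le> r" "r ^ p \<le> 1/3"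
  shows "summable (\<lambda>n. norm (a n) * r ^ (p * n + 1))"
    and "(\<Sum>n. norm (a n) * r ^ (p * n + 1)) \<le> r * M"
proof -
  have hol: "h holomorphic_on ball 0 1"
    and sums: "\<And>z. norm z < 1 \<Longrightarrow> (\<lambda>n. a n * z ^ (p * n + 1)) sums h z"
    using h by (auto simp: p_symmetric_analytic_def analytic_imp_holomorphic)
  have M: "0 \<le> M"
    using order_trans[OF norm_ge_zero le[of 0]] by simp
  have h0: "h 0 = 0"
    using sums[of 0] by (simp add: sums_iff)
  have Schwarz: "norm (h z) \<le> K * norm z" if "M < K" "norm z < 1" for K z
  proof -
    have K: "K > 0"
      using M that by simp
    have "norm (h w / of_real K) < 1" if "norm w < 1" for w
      using le[OF that] \<open>M < K\<close> K by (simp add: norm_divide)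
    then have "norm (h z / of_real K) \<le> norm z"
      using K h0 that by (intro Schwarz_Lemma(1)) (auto intro!: holomorphic_intros hol)
    then show ?thesis
      using K by (simp add: norm_divide field_simps)
  qed
  define H where "H u = (\<Sum>n. a n * u ^ n)" for u
  have H_sums: "(\<lambda>n. a n * u ^ n) sums H u"
    and H_le: "u \<noteq> 0 \<Longrightarrow> M < K \<Longrightarrow> norm (H u) \<le> K" if u: "norm u < 1" for u K
  proof -
    have "summable (\<lambda>n. a n * u ^ n) \<and> (u \<noteq> 0 \<longrightarrow> M < K \<longrightarrow> norm (H u) \<le> K)"
    proof (cases "u = 0")
      case False
      \<comment> \<open>At a \<open>p\<close>-th root \<open>z\<close> of \<open>u\<close> the series of \<open>H\<close> becomes that of \<open>h z / z\<close>.\<close>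
      obtain z where z: "u = z ^ p"
        using exists_complex_root p by blast
      have nz: "norm z < 1"
        using u power_less_imp_less_base[of "norm z" p 1] by (simp add: z norm_power)
      have z0: "z \<noteq> 0"
        using False p unfolding z by auto
      have "(\<lambda>n. a n * u ^ n) sums (h z / z)"
        using sums_divide[OF sums[OF nz], of z] z0 by (simp add: z power_mult)
      moreover have "norm (h z / z) \<le> K" if "M < K"
        using Schwarz[OF that nz] z0 by (simp add: norm_divide divide_simps)
      ultimately show ?thesis
        by (auto simp: H_def sums_iff)
    qed simp
    then show "(\<lambda>n. a n * u ^ n) sums H u" "u \<noteq> 0 \<Longrightarrow> M < K \<Longrightarrow> norm (H u) \<le> K"
      by (auto simp: H_def)
  qed
  have H_lt: "norm (H u) < K" if K: "M < K" and u: "norm u < 1" for K u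
  proof -
    obtain K' where K': "M < K'" "K' < K"
      using K dense by blast
    have "norm (H u) \<le> K'"
    proof (cases "u = 0")
      case True
      \<comment> \<open>\<open>h z / z\<close> says nothing at \<open>z = 0\<close>; the bound on the punctured disk passes to the limit.\<close>
      have "isCont H 0"
        using power_series_on_disk(2)[OF H_sums] by (rule DERIV_isCont)
      then have "((\<lambda>v. norm (H v)) \<longlongrightarrow> norm (H 0)) (at 0)"
        by (intro tendsto_norm) (simp add: isCont_def)
      moreover have "\<forall>\<^sub>F v in at 0. norm (H v) \<le> K'"
        unfolding eventually_at using H_le[OF _ _ K'(1)] by (intro exI[of _ 1]) simp
      ultimately show ?thesis
        unfolding True by (rule tendsto_upperbound) simp
    qed (use H_le u K' in blast)
    then show ?thesis
      using K' by simp
  qed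
  have scaled: "summable (\<lambda>n. norm (a n) * (r ^ p) ^ n) \<and> (\<Sum>n. norm (a n) * (r ^ p) ^ n) \<le> K"
    if K: "M < K" for K
  proof -
    have K0: "K > 0"
      using M K by simp
    have "(\<lambda>n. a n / of_real K * u ^ n) sums (H u / of_real K)" if "norm u < 1" for u
      using sums_divide[of "\<lambda>n. a n * u ^ n" "H u" "of_real K"] H_sums[OF that] by simp
    moreover have "norm (H u / of_real K) < 1" if "norm u < 1" for u
      using H_lt[OF K that] K0 by (simp add: norm_divide)
    ultimately have *: "summable (\<lambda>n. norm (a n / of_real K) * (r ^ p) ^ n)"
      "(\<Sum>n. norm (a n / of_real K) * (r ^ p) ^ n) \<le> 1"
      using Bohr[of "\<lambda>n. a n / of_real K" "\<lambda>u. H u / of_real K" "r ^ p"] r by auto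
    have eq: "norm (a n) * (r ^ p) ^ n = K * (norm (a n / of_real K) * (r ^ p) ^ n)" for n
      using K0 by (simp add: norm_divide)
    show ?thesis
      unfolding eq using K0 * by (auto simp: suminf_mult intro!: summable_mult)
  qed
  have summ: "summable (\<lambda>n. norm (a n) * (r ^ p) ^ n)"
    using scaled[of "M + 1"] by simp
  have bound: "(\<Sum>n. norm (a n) * (r ^ p) ^ n) \<le> M"
    by (rule dense_ge) (rule conjunct2[OF scaled])
  have eq: "norm (a n) * r ^ (p * n + 1) = r * (norm (a n) * (r ^ p) ^ n)" for n
    by (simp add: power_mult)
  show "summable (\<lambda>n. norm (a n) * r ^ (p * n + 1))"
    unfolding eq using summ by (rule summable_mult)
  show "(\<Sum>n. norm (a n) * r ^ (p * n + 1)) \<le> r * M"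
    unfolding eq using suminf_mult[OF summ] mult_left_mono[OF bound r(1)] by simp
qed

lemma norm_le_disk_sup_norm:
  assumes "bounded (F ` ball 0 1)" "norm z < 1"
  shows "norm (F z) \<le> disk_sup_norm F"
proof -
  have "bdd_above ((\<lambda>z. norm (F z)) ` ball 0 1)"
    using assms(1) by (auto simp: bounded_iff bdd_above_def)
  then show ?thesis
    unfolding disk_sup_norm_def using assms(2) by (intro cSUP_upper) auto
qed

text \<open>The identity is the case \<open>H = 1\<close>: it has the largest first coefficient that the Schwarz lemma
  permits.\<close>

lemma p_symmetric_identity:
  "p_symmetric_analytic p (\<lambda>n. if n = 0 then 1 else 0) (\<lambda>z. z)"
proof -
  have "(\<lambda>n. (if n = 0 then 1 else 0) * z ^ (p * n + 1)) sums z" for z :: complex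
    using sums_finite[of "{0}" "\<lambda>n. (if n = 0 then 1 else 0) * z ^ (p * n + 1)"] by simp
  then show ?thesis
    by (auto simp: p_symmetric_analytic_def)
qed

theorem theorem5:
  fixes p :: nat
  assumes "p \<ge> 2"
  shows "(\<forall>f h g a b.
            p_symmetric_harmonic p f h g a b \<and>
            bounded (h ` ball 0 1) \<and> bounded (g ` ball 0 1) \<longrightarrow>
            (\<forall>r::real. 0 \<le> r \<and> r \<le> 1/2 \<longrightarrow>
               summable (\<lambda>n. (norm (a n) + norm (b n)) * r ^ (p * n + 1)) \<and>
               (\<Sum>n. (norm (a n) + norm (b n)) * r ^ (p * n + 1))
                 \<le> max (disk_sup_norm h) (disk_sup_norm g))) \<and>
         (\<forall>r::real. 1/2 < r \<and> r < 1 \<longrightarrow>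
            (\<exists>f h g a b.
               p_symmetric_harmonic p f h g a b \<and>
               bounded (h ` ball 0 1) \<and> bounded (g ` ball 0 1) \<and>
               summable (\<lambda>n. (norm (a n) + norm (b n)) * r ^ (p * n + 1)) \<and>
               \<not> (\<Sum>n. (norm (a n) + norm (b n)) * r ^ (p * n + 1))
                   \<le> max (disk_sup_norm h) (disk_sup_norm g)))"
proof (intro conjI allI impI)
  fix f h g a b and r :: real
  assume f: "p_symmetric_harmonic p f h g a b \<and> bounded (h ` ball 0 1) \<and> bounded (g ` ball 0 1)"
    and r: "0 \<le> r \<and> r \<le> 1/2"
  have "r ^ p \<le> (1/2) ^ p"
    using r by (intro power_mono) auto
  also have "\<dots> \<le> (1/2) ^ 2"
    using assms by (intro power_decreasing) auto
  finally have rp: "r ^ p \<le> 1/3"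
    by (simp add: power2_eq_square)
  have p: "p > 0"
    using assms by simp
  have a: "p_symmetric_analytic p a h" and b: "p_symmetric_analytic p b g"
    using f by (auto simp: p_symmetric_harmonic_def)
  have le_h: "\<And>z. norm z < 1 \<Longrightarrow> norm (h z) \<le> disk_sup_norm h"
    and le_g: "\<And>z. norm z < 1 \<Longrightarrow> norm (g z) \<le> disk_sup_norm g"
    using f norm_le_disk_sup_norm by blast+
  note A = p_symmetric_Bohr[OF a le_h p _ rp]
  note B = p_symmetric_Bohr[OF b le_g p _ rp]
  show "summable (\<lambda>n. (norm (a n) + norm (b n)) * r ^ (p * n + 1))"
    using summable_add[OF A(1) B(1)] r by (simp add: distrib_right)
  have "(\<Sum>n. (norm (a n) + norm (b n)) * r ^ (p * n + 1))
      = (\<Sum>n. norm (a n) * r ^ (p * n + 1)) + (\<Sum>n. norm (b n) * r ^ (p * n + 1))"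
    using suminf_add[OF A(1) B(1)] r by (simp add: distrib_right)
  also have "\<dots> \<le> r * disk_sup_norm h + r * disk_sup_norm g"
    using A(2) B(2) r by (intro add_mono) auto
  also have "\<dots> \<le> 1/2 * disk_sup_norm h + 1/2 * disk_sup_norm g"
    using r order_trans[OF norm_ge_zero le_h[of 0]] order_trans[OF norm_ge_zero le_g[of 0]]
    by (intro add_mono mult_right_mono) auto
  also have "\<dots> \<le> max (disk_sup_norm h) (disk_sup_norm g)"
    by simp
  finally show "(\<Sum>n. (norm (a n) + norm (b n)) * r ^ (p * n + 1))
      \<le> max (disk_sup_norm h) (disk_sup_norm g)" .
next
  fix r :: real
  assume r: "1/2 < r \<and> r < 1"
  define c :: "nat \<Rightarrow> complex" where "c = (\<lambda>n. if n = 0 then 1 else 0)"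
  have "p_symmetric_harmonic p (\<lambda>z. z + cnj z) (\<lambda>z. z) (\<lambda>z. z) c c"
    using p_symmetric_identity by (simp add: p_symmetric_harmonic_def c_def)
  moreover have "bounded ((\<lambda>z::complex. z) ` ball 0 1)"
    by simp
  moreover have sums: "(\<lambda>n. (norm (c n) + norm (c n)) * r ^ (p * n + 1)) sums (2 * r)"
    using sums_single[of 0 "\<lambda>n. 2 * r ^ (p * n + 1)"]
    by (simp add: c_def if_distrib if_distribR cong: if_cong)
  moreover have "disk_sup_norm (\<lambda>z. z) \<le> 1"
    unfolding disk_sup_norm_def by (rule cSUP_least) auto
  ultimately show "\<exists>f h g a b. p_symmetric_harmonic p f h g a b \<and>
      bounded (h ` ball 0 1) \<and> bounded (g ` ball 0 1) \<and>
      summable (\<lambda>n. (norm (a n) + norm (b n)) * r ^ (p * n + 1)) \<and>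
      \<not> (\<Sum>n. (norm (a n) + norm (b n)) * r ^ (p * n + 1))
          \<le> max (disk_sup_norm h) (disk_sup_norm g)"
    using r
    by (intro exI[of _ "\<lambda>z. z + cnj z"] exI[of _ "\<lambda>z. z"] exI[of _ c] conjI)
      (auto simp: sums_iff)
qed

end
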